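(* Let $\phi:\mathbb{R}^n\to\mathbb{R}^n$ be a global $C^\infty$-diffeomorphism with $|J_\phi(x)|=|\det D\phi(x)|\neq 0$ for all $x$, and let $\omega\in C^\infty(\mathbb{R}^n;\mathbb{C})$ be nowhere vanishing. If $f,g\in\mathcal{S}_{\phi,\omega}(\mathbb{R}^n)$, then $$\mathcal{F}_{\phi,\omega}[f*_{\phi,\omega}g]=\mathcal{F}_{\phi,\omega}f\cdot\mathcal{F}_{\phi,\omega}g .$$
   Context: $\mathcal{S}_{\phi,\omega}(\mathbb{R}^n)=\{f:\mathbb{R}^n\to\mathbb{C}\mid (\omega f)\circ\phi^{-1}\in\mathcal{S}(\mathbb{R}^n)\}$, with $\mathcal{S}(\mathbb{R}^n)$ the classical Schwartz space. The weighted Fourier transform is $$[\mathcal{F}_{\phi,\omega}f](\xi)=\frac{1}{(2\pi)^{n/2}}\int_{\mathbb{R}^n}e^{-i\xi\cdot\phi(x)}\,\omega(x)f(x)\,|J_\phi(x)|\,dx .$$ The generalized convolution is $$(f*_{\phi,\omega}g)(x)=\frac{1}{\omega(x)(2\pi)^{n/2}}\int_{\mathbb{R}^n}\tilde f\big(\phi(x)-\phi(y)\big)\,\tilde g\big(\phi(y)\big)\,|J_\phi(y)|\,dy,$$ where $\tilde f=(\omega f)\circ\phi^{-1}$ and $\tilde g=(\omega g)\circ\phi^{-1}$. *)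

theory Defs
  imports "HOL-Analysis.Analysis"
begin

definition partial_deriv ::
    "'n::finite \<Rightarrow> (real^'n \<Rightarrow> 'b::real_normed_vector) \<Rightarrow> real^'n \<Rightarrow> 'b" where
  "partial_deriv i f x = frechet_derivative f (at x) (axis i 1)"

primrec k_times_cont_differentiable ::
    "nat \<Rightarrow> (real^'n::finite \<Rightarrow> 'b::real_normed_vector) \<Rightarrow> bool" where
  "k_times_cont_differentiable 0 f \<longleftrightarrow> continuous_on UNIV f"
| "k_times_cont_differentiable (Suc k) f \<longleftrightarrow>
     (\<forall>x. f differentiable (at x)) \<and> (\<forall>i. k_times_cont_differentiable k (partial_deriv i f))"

definition smooth :: "(real^'n::finite \<Rightarrow> 'b::real_normed_vector) \<Rightarrow> bool" where
  "smooth f \<longleftrightarrow> (\<forall>k. k_times_cont_differentiable k f)"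

definition diffeomorphism :: "(real^'n::finite \<Rightarrow> real^'n) \<Rightarrow> bool" where
  "diffeomorphism \<phi> \<longleftrightarrow> bij \<phi> \<and> smooth \<phi> \<and> smooth (inv \<phi>)"

(* A derivative of order m is given by the list of the m coordinates that are differentiated.
   On smooth functions the order of differentiation does not matter, so these are exactly the
   derivatives indexed by multi-indices. *)
definition iterated_partial ::
    "'n::finite list \<Rightarrow> (real^'n \<Rightarrow> 'b::real_normed_vector) \<Rightarrow> real^'n \<Rightarrow> 'b" where
  "iterated_partial js f = foldr partial_deriv js f"

definition monomial_at :: "('n::finite \<Rightarrow> nat) \<Rightarrow> real^'n \<Rightarrow> real" where
  "monomial_at \<alpha> x = (\<Prod>i\<in>UNIV. (x $ i) ^ \<alpha> i)"

definition schwartz_space :: "(real^'n::finite \<Rightarrow> complex) set" where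
  "schwartz_space =
     {f. smooth f \<and> (\<forall>\<alpha> js. bounded (range (\<lambda>x. monomial_at \<alpha> x *\<^sub>R iterated_partial js f x)))}"

definition abs_jacobian :: "(real^'n::finite \<Rightarrow> real^'n) \<Rightarrow> real^'n \<Rightarrow> real" where
  "abs_jacobian \<phi> x = \<bar>det (jacobian \<phi> (at x))\<bar>"

definition weighted_pullback ::
    "(real^'n::finite \<Rightarrow> real^'n) \<Rightarrow> (real^'n \<Rightarrow> complex) \<Rightarrow> (real^'n \<Rightarrow> complex) \<Rightarrow> real^'n \<Rightarrow> complex"
  where "weighted_pullback \<phi> \<omega> f = (\<lambda>x. \<omega> x * f x) \<circ> inv \<phi>"

definition weighted_schwartz_space ::
    "(real^'n::finite \<Rightarrow> real^'n) \<Rightarrow> (real^'n \<Rightarrow> complex) \<Rightarrow> (real^'n \<Rightarrow> complex) set" where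
  "weighted_schwartz_space \<phi> \<omega> = {f. weighted_pullback \<phi> \<omega> f \<in> schwartz_space}"

definition weighted_fourier ::
    "(real^'n::finite \<Rightarrow> real^'n) \<Rightarrow> (real^'n \<Rightarrow> complex) \<Rightarrow> (real^'n \<Rightarrow> complex) \<Rightarrow> real^'n \<Rightarrow> complex"
  where
  "weighted_fourier \<phi> \<omega> f \<xi> =
     1 / complex_of_real ((2 * pi) powr (real CARD('n) / 2)) *
     (LINT x|lborel. exp (- (\<i> * complex_of_real (\<xi> \<bullet> \<phi> x))) * \<omega> x * f x *
        complex_of_real (abs_jacobian \<phi> x))"

definition weighted_convolution ::
    "(real^'n::finite \<Rightarrow> real^'n) \<Rightarrow> (real^'n \<Rightarrow> complex) \<Rightarrow>
     (real^'n \<Rightarrow> complex) \<Rightarrow> (real^'n \<Rightarrow> complex) \<Rightarrow> real^'n \<Rightarrow> complex"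
  where
  "weighted_convolution \<phi> \<omega> f g x =
     1 / (\<omega> x * complex_of_real ((2 * pi) powr (real CARD('n) / 2))) *
     (LINT y|lborel. weighted_pullback \<phi> \<omega> f (\<phi> x - \<phi> y) * weighted_pullback \<phi> \<omega> g (\<phi> y) *
        complex_of_real (abs_jacobian \<phi> y))"

end

(*
  Put F = (\<omega> f) \<circ> \<phi>^{-1} and G = (\<omega> g) \<circ> \<phi>^{-1}. The substitution u = \<phi>(x) turns the weighted
  transform of f into the classical Fourier transform of F, and \<omega> times the weighted convolution
  into the classical convolution of F and G composed with \<phi>. The classical convolution theorem
  follows from Fubini and translation invariance, because Schwartz functions are integrable.
  The substitution rule is proved as an identity of measures: the image of |J_\<phi>| dx under \<phi> is
  Lebesgue measure. In this form it applies to Bochner integrals without integrability conditions.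
*)
theory Submission
  imports Defs "HOL-Probability.Sinc_Integral"
begin

section \<open>Change of variables for the Lebesgue measure\<close>

text \<open>The change of variables theorems of HOL-Analysis require an index type of class \<^class>\<open>wellorder\<close>.
  This type has the cardinality of the given index type and such an order; results are carried over
  by permuting coordinates.\<close>

typedef ('n::finite) ordered_index = "{..<CARD('n)}"
  morphisms nat_of_index index_of_nat
  by (rule exI[of _ 0]) simp

setup_lifting type_definition_ordered_index

instantiation ordered_index :: (finite) linorder
begin

lift_definition less_eq_ordered_index :: "'a ordered_index \<Rightarrow> 'a ordered_index \<Rightarrow> bool" is "(\<le>)" .

lift_definition less_ordered_index :: "'a ordered_index \<Rightarrow> 'a ordered_index \<Rightarrow> bool" is "(<)" .

instance
  by standard (transfer; fastforce)+

end

lemma bij_betw_nat_of_index: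
  "bij_betw nat_of_index (UNIV :: 'n::finite ordered_index set) {..<CARD('n)}"
  using type_definition.Rep_range[OF type_definition_ordered_index]
  by (auto simp: bij_betw_def inj_on_def nat_of_index_inject)

text \<open>The order is the one pulled back from the naturals, so well-founded induction is
  induction on \<open>nat_of_index\<close>.\<close>

instance ordered_index :: (finite) "{finite, wellorder}"
proof
  show "finite (UNIV :: 'a ordered_index set)"
    by (rule bij_betw_finite[OF bij_betw_nat_of_index, THEN iffD2]) (rule finite_lessThan)
next
  fix P :: "'a ordered_index \<Rightarrow> bool" and a
  assume step: "\<And>x. (\<And>y. y < x \<Longrightarrow> P y) \<Longrightarrow> P x"
  show "P a"
  proof (induction a rule: measure_induct_rule[of nat_of_index])
    case (less x)
    show ?case
    proof (rule step)
      fix y assume "y < x"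
      then have "nat_of_index y < nat_of_index x"
        by (simp only: less_ordered_index.rep_eq)
      then show "P y" by (rule less)
    qed
  qed
qed

lemma ex_bij_ordered_index: "\<exists>r :: 'n::finite ordered_index \<Rightarrow> 'n. bij r"
proof -
  have "card (UNIV :: 'n ordered_index set) = CARD('n)"
    using bij_betw_same_card[OF bij_betw_nat_of_index] by simp
  then show ?thesis
    using finite_same_card_bij[of "UNIV :: 'n ordered_index set" "UNIV :: 'n set"]
    by (simp only: finite)
qed

section \<open>Permutation of coordinates: determinants and Lebesgue measure\<close>

text \<open>Composition of a vector, seen as a function on indices, with \<open>r\<close>. The
  direction is contravariant; for bijective \<open>r\<close> this is the linear isomorphism that
  renames coordinates.\<close>

definition reindex :: "('m::finite \<Rightarrow> 'n::finite) \<Rightarrow> 'a^'n \<Rightarrow> 'a^'m" where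
  "reindex r x = (\<chi> i. x $ r i)"

lemma reindex_nth [simp]: "reindex r x $ i = x $ r i"
  by (simp add: reindex_def)

lemma bounded_linear_reindex: "bounded_linear (reindex r :: real^'n::finite \<Rightarrow> real^'m::finite)"
  by (intro linear_conv_bounded_linear[THEN iffD1] linearI) (simp_all add: vec_eq_iff)

lemma borel_measurable_reindex [measurable]:
  "(reindex r :: real^'n::finite \<Rightarrow> real^'m::finite) \<in> borel \<rightarrow>\<^sub>M borel"
  by (intro borel_measurable_continuous_onI linear_continuous_on bounded_linear_reindex)

lemma reindex_inv:
  assumes "bij r"
  shows "reindex r (reindex (inv r) x) = x" "reindex (inv r) (reindex r y) = y"
  using assms by (simp_all add: vec_eq_iff bij_is_inj bij_is_surj surj_f_inv_f)

text \<open>Conjugation with \<open>r\<close> is a sign-preserving bijection between the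
  permutations of the two index types, and it matches the terms of the two Leibniz sums.\<close>

lemma det_reindex:
  fixes A :: "'a::comm_ring_1^'n::finite^'n" and r :: "'m::finite \<Rightarrow> 'n"
  assumes "bij r"
  shows "det (\<chi> i j. A $ r i $ r j) = det A"
proof -
  have inj: "inj r" and bb: "bij_betw r UNIV UNIV"
    using assms by (auto simp: bij_def)
  have inv: "bij_betw (inv r) UNIV UNIV"
    using assms by (simp add: bij_imp_bij_inv)
  let ?m = "map_permutation UNIV r"
  show ?thesis
    unfolding det_def
  proof (rule sum.reindex_bij_witness[where j = ?m and i = "map_permutation UNIV (inv r)"])
    fix p assume "p \<in> {p. p permutes (UNIV :: 'm set)}"
    then have p: "p permutes UNIV" by simp
    show "map_permutation UNIV (inv r) (?m p) = p"
      by (rule map_permutation_compose_inv[OF bb p]) (simp add: inj)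
    show "?m p \<in> {p. p permutes UNIV}"
      using map_permutation_permutes[OF bb p] by simp
    \<comment> \<open>The conjugate of \<open>p\<close> sends \<open>r i\<close> to
      \<open>r (p i)\<close>, so the factors are first renumbered along \<open>r\<close>.\<close>
    have "(\<Prod>i\<in>UNIV. A $ i $ ?m p i) = (\<Prod>i\<in>UNIV. A $ r i $ ?m p (r i))"
      by (rule prod.reindex_bij_betw[OF bb, symmetric])
    also have "\<dots> = (\<Prod>i\<in>UNIV. A $ r i $ r (p i))"
      by (simp add: map_permutation_apply inj)
    finally show "of_int (sign (?m p)) * (\<Prod>i\<in>UNIV. A $ i $ ?m p i) =
      of_int (sign p) * (\<Prod>i\<in>UNIV. (\<chi> i j. A $ r i $ r j) $ i $ p i)"
      using sign_map_permutation[OF inj p] by simp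
  next
    fix q assume "q \<in> {q. q permutes (UNIV :: 'n set)}"
    then have q: "q permutes UNIV" by simp
    show "?m (map_permutation UNIV (inv r) q) = q"
      by (rule map_permutation_compose_inv[OF inv q]) (simp add: assms bij_is_surj surj_f_inv_f)
    show "map_permutation UNIV (inv r) q \<in> {p. p permutes UNIV}"
      using map_permutation_permutes[OF inv q] by simp
  qed
qed

text \<open>Box volumes and product integrals are stated over \<open>Basis\<close>; this passes from
  there to coordinates.\<close>

lemma prod_Basis_vec: "(\<Prod>b\<in>Basis. f (x \<bullet> b)) = (\<Prod>i\<in>UNIV. f (x $ i))" for x :: "real^'n::finite"
proof -
  have "(\<Prod>b\<in>Basis. f (x \<bullet> b)) = (\<Prod>b\<in>range (\<lambda>i. axis i 1). f (x \<bullet> b))"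
    by (rule prod.cong) (auto simp: Basis_vec_def)
  also have "\<dots> = (\<Prod>i\<in>UNIV. f (x $ i))"
    by (subst prod.reindex) (auto simp: inj_on_def axis_eq_axis inner_axis)
  finally show ?thesis .
qed

text \<open>Lebesgue measure is determined by the volumes of boxes. The preimage of a box is the box
  with its sides permuted, whose volume is the same product in another order.\<close>

lemma lborel_distr_reindex:
  fixes r :: "'m::finite \<Rightarrow> 'n::finite"
  assumes "bij r"
  shows "distr lborel borel (reindex r) = (lborel :: (real^'m) measure)"
proof (rule lborel_eqI[symmetric])
  fix l u :: "real^'m"
  assume le: "\<And>b. b \<in> Basis \<Longrightarrow> l \<bullet> b \<le> u \<bullet> b"
  let ?T = "reindex (inv r) :: real^'m \<Rightarrow> real^'n"
  have le': "l $ i \<le> u $ i" for i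
    using le[of "axis i 1"] by (simp add: inner_axis axis_in_Basis_iff)
  then have le'': "?T l \<bullet> b \<le> ?T u \<bullet> b" if "b \<in> Basis" for b
    using that by (auto simp: Basis_vec_def inner_axis)
  have "reindex r -` box l u = box (?T l) (?T u)"
  proof (intro set_eqI iffI)
    fix x :: "real^'n"
    assume x: "x \<in> reindex r -` box l u"
    have "l $ inv r i < x $ i \<and> x $ i < u $ inv r i" for i
      using x assms by (force simp: mem_box_cart bij_is_surj surj_f_inv_f dest!: spec[of _ "inv r i"])
    then show "x \<in> box (?T l) (?T u)" by (simp add: mem_box_cart)
  next
    fix x assume x: "x \<in> box (?T l) (?T u)"
    have "l $ i < x $ r i \<and> x $ r i < u $ i" for i
      using x assms by (force simp: mem_box_cart bij_is_inj dest!: spec[of _ "r i"])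
    then show "x \<in> reindex r -` box l u" by (simp add: mem_box_cart)
  qed
  then have "emeasure (distr lborel borel (reindex r)) (box l u) = (\<Prod>b\<in>Basis. (?T u - ?T l) \<bullet> b)"
    using le'' by (simp add: emeasure_distr emeasure_lborel_box)
  also have "(\<Prod>b\<in>Basis. (?T u - ?T l) \<bullet> b) = (\<Prod>i\<in>UNIV. (u - l) $ inv r i)"
    by (simp add: prod_Basis_vec[of "\<lambda>t. t"])
  also have "\<dots> = (\<Prod>i\<in>UNIV. (u - l) $ i)"
    using assms by (intro prod.reindex_bij_betw) (simp add: bij_imp_bij_inv)
  finally show "emeasure (distr lborel borel (reindex r)) (box l u) = (\<Prod>b\<in>Basis. (u - l) \<bullet> b)"
    by (simp add: prod_Basis_vec[of "\<lambda>t. t"])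
qed simp

section \<open>Image of the Jacobian density under a differentiable bijection\<close>

lemma has_derivative_imp_borel_measurable:
  fixes f :: "real^'n::finite \<Rightarrow> real^'m::finite"
  assumes "\<And>x. (f has_derivative f' x) (at x)"
  shows "f \<in> borel \<rightarrow>\<^sub>M borel"
  using assms has_derivative_continuous_on[of UNIV f f']
  by (auto intro: borel_measurable_continuous_onI has_derivative_at_withinI)

text \<open>It suffices to test boxes. The preimage \<open>S\<close> of a box is mapped injectively
  onto it, so the area formula for differentiable images gives the volume of the box as the integral
  of the Jacobian over \<open>S\<close>.\<close>

lemma lborel_distr_density_det_wellorder:
  fixes \<phi> :: "real^'n::{finite,wellorder} \<Rightarrow> real^'n::_"
  assumes der: "\<And>x. (\<phi> has_derivative \<phi>' x) (at x)"
    and "bij \<phi>"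
    and [measurable]: "(\<lambda>x. det (matrix (\<phi>' x))) \<in> borel_measurable borel"
  shows "distr (density lborel (\<lambda>x. ennreal \<bar>det (matrix (\<phi>' x))\<bar>)) borel \<phi> = lborel"
proof (rule lborel_eqI[symmetric])
  fix l u :: "real^'n::_"
  assume le: "\<And>b. b \<in> Basis \<Longrightarrow> l \<bullet> b \<le> u \<bullet> b"
  note [measurable] = has_derivative_imp_borel_measurable[OF der]
  let ?J = "\<lambda>x. \<bar>det (matrix (\<phi>' x))\<bar>"
  define S where "S = \<phi> -` box l u"
  have S [measurable]: "S \<in> sets borel"
    unfolding S_def using measurable_sets[OF has_derivative_imp_borel_measurable[OF der]] by simp
  have img: "\<phi> ` S = box l u"
    unfolding S_def using \<open>bij \<phi>\<close> by (simp add: bij_is_surj)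
  have "(?J has_integral measure lebesgue (box l u)) S"
  proof (subst has_measure_differentiable_image[symmetric])
    show "S \<in> sets lebesgue" using S by (simp add: sets_completionI_sets)
    show "(\<phi> has_derivative \<phi>' x) (at x within S)" for x
      using der by (rule has_derivative_at_withinI)
    show "inj_on \<phi> S" using \<open>bij \<phi>\<close> by (meson bij_is_inj inj_on_subset subset_UNIV)
  qed (simp add: img)
  \<comment> \<open>The integrand is nonnegative, which permits the passage from the gauge integral
    to the Lebesgue integral.\<close>
  then have "(\<integral>\<^sup>+x. ennreal (?J x) * indicator S x \<partial>lborel) = measure lebesgue (box l u)"
    by (intro nn_integral_has_integral_lebesgue') auto
  also have "measure lebesgue (box l u) = (\<Prod>b\<in>Basis. (u - l) \<bullet> b)"
    using le by (simp add: measure_lborel_box)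
  finally show "emeasure (distr (density lborel (\<lambda>x. ennreal (?J x))) borel \<phi>) (box l u) =
      (\<Prod>b\<in>Basis. (u - l) \<bullet> b)"
    using S by (simp add: emeasure_distr emeasure_density S_def)
qed simp

text \<open>Conjugation by a renaming of coordinates reduces this to the well-ordered case: the
  renaming preserves Lebesgue measure, and the Jacobian determinant is unchanged.\<close>

lemma lborel_distr_density_det:
  fixes \<phi> :: "real^'n::finite \<Rightarrow> real^'n"
  assumes der: "\<And>x. (\<phi> has_derivative \<phi>' x) (at x)"
    and "bij \<phi>"
    and [measurable]: "(\<lambda>x. det (matrix (\<phi>' x))) \<in> borel_measurable borel"
  shows "distr (density lborel (\<lambda>x. ennreal \<bar>det (matrix (\<phi>' x))\<bar>)) borel \<phi> = lborel"
proof -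
  obtain r :: "'n ordered_index \<Rightarrow> 'n" where r: "bij r"
    using ex_bij_ordered_index by blast
  let ?T = "reindex r :: real^'n \<Rightarrow> real^'n ordered_index"
  let ?T' = "reindex (inv r) :: real^'n ordered_index \<Rightarrow> real^'n"
  note [measurable] = has_derivative_imp_borel_measurable[OF der]
  define \<psi> where "\<psi> = ?T \<circ> \<phi> \<circ> ?T'"
  define \<psi>' where "\<psi>' y = ?T \<circ> \<phi>' (?T' y) \<circ> ?T'" for y
  have der\<psi>: "(\<psi> has_derivative \<psi>' y) (at y)" for y
    unfolding \<psi>_def \<psi>'_def
    by (intro diff_chain_at bounded_linear_imp_has_derivative bounded_linear_reindex der)
  note [measurable] = has_derivative_imp_borel_measurable[OF der\<psi>]
  have T'_axis: "?T' (axis j 1) = axis (r j) 1" for j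
    using r by (auto simp: vec_eq_iff axis_def bij_is_inj bij_is_surj surj_f_inv_f)
  \<comment> \<open>Since \<open>?T'\<close> maps unit vectors to unit vectors, rows and columns are
    both permuted by \<open>r\<close>.\<close>
  have "matrix (\<psi>' y) = (\<chi> i j. matrix (\<phi>' (?T' y)) $ r i $ r j)" for y
    by (simp add: vec_eq_iff matrix_def \<psi>'_def T'_axis)
  then have det: "det (matrix (\<psi>' y)) = det (matrix (\<phi>' (?T' y)))" for y
    by (simp add: det_reindex[OF r])
  have bij_T: "bij ?T"
    by (rule bij_betw_byWitness[of _ ?T']) (simp_all add: reindex_inv[OF r])
  have bij_T': "bij ?T'"
    by (rule bij_betw_byWitness[of _ ?T]) (simp_all add: reindex_inv[OF r])
  have bij\<psi>: "bij \<psi>"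
    unfolding \<psi>_def using \<open>bij \<phi>\<close> bij_T bij_T' by (simp add: bij_comp)
  have cov: "distr (density lborel (\<lambda>y. ennreal \<bar>det (matrix (\<psi>' y))\<bar>)) borel \<psi> = lborel"
    by (rule lborel_distr_density_det_wellorder[OF der\<psi> bij\<psi>]) (simp add: det)
  show ?thesis
  proof (rule measure_eqI)
    fix A assume "A \<in> sets (distr (density lborel (\<lambda>x. ennreal \<bar>det (matrix (\<phi>' x))\<bar>)) borel \<phi>)"
    then have [measurable]: "A \<in> sets borel" by simp
    have T'_distr: "distr lborel borel ?T' = lborel"
      using lborel_distr_reindex[of "inv r"] r by (simp add: bij_imp_bij_inv)
    have T': "(\<integral>\<^sup>+x. h x \<partial>lborel) = (\<integral>\<^sup>+y. h (?T' y) \<partial>lborel)"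
      if "h \<in> borel_measurable borel" for h :: "real^'n \<Rightarrow> ennreal"
      using nn_integral_distr[of ?T' lborel borel h] that by (simp add: T'_distr)
    have "emeasure (distr (density lborel (\<lambda>x. ennreal \<bar>det (matrix (\<phi>' x))\<bar>)) borel \<phi>) A =
        (\<integral>\<^sup>+x. indicator A x \<partial>distr (density lborel (\<lambda>x. ennreal \<bar>det (matrix (\<phi>' x))\<bar>)) borel \<phi>)"
      by simp
    also have "\<dots> = (\<integral>\<^sup>+x. ennreal \<bar>det (matrix (\<phi>' x))\<bar> * indicator A (\<phi> x) \<partial>lborel)"
      by (subst nn_integral_distr) (simp_all add: nn_integral_density)
    \<comment> \<open>Substitution of \<open>?T' y\<close> for \<open>x\<close>, with
      \<open>\<phi> (?T' y) = ?T' (\<psi> y)\<close>; the rule for \<open>\<psi>\<close> then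
      applies, and the last step undoes the renaming.\<close>
    also have "\<dots> = (\<integral>\<^sup>+y. ennreal \<bar>det (matrix (\<psi>' y))\<bar> * indicator A (?T' (\<psi> y)) \<partial>lborel)"
      by (subst T') (simp_all add: det \<psi>_def reindex_inv[OF r])
    also have "\<dots> = (\<integral>\<^sup>+y. indicator A (?T' y) \<partial>distr (density lborel (\<lambda>y. ennreal \<bar>det (matrix (\<psi>' y))\<bar>)) borel \<psi>)"
      by (subst nn_integral_distr) (simp_all add: nn_integral_density det)
    also have "\<dots> = (\<integral>\<^sup>+x. indicator A x \<partial>lborel)"
      unfolding cov by (rule T'[symmetric]) simp
    finally show "emeasure (distr (density lborel (\<lambda>x. ennreal \<bar>det (matrix (\<phi>' x))\<bar>)) borel \<phi>) A =
        emeasure lborel A"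
      by simp
  qed simp
qed


section \<open>Integrability of Schwartz functions\<close>

text \<open>Expanding the product picks a subset \<open>X\<close> of coordinates. The weight thus
  becomes a sum of monomials, each of which the Schwartz seminorms control.\<close>

lemma prod_one_plus_eq_sum_monomial_at:
  "(\<Prod>i\<in>UNIV. 1 + (x $ i)\<^sup>2) = (\<Sum>X\<in>UNIV. monomial_at (\<lambda>i. if i \<in> X then 2 else 0) x)"
  for x :: "real^'n::finite"
proof -
  have "(\<Prod>i\<in>UNIV. (x $ i)\<^sup>2 + 1) = (\<Sum>X\<in>UNIV. \<Prod>i\<in>X. (x $ i)\<^sup>2)"
    by (subst prod_add) simp_all
  also have "\<dots> = (\<Sum>X\<in>UNIV. monomial_at (\<lambda>i. if i \<in> X then 2 else 0) x)"
  proof (rule sum.cong)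
    fix X :: "'n set"
    have "(\<Prod>i\<in>UNIV. (x $ i) ^ (if i \<in> X then 2 else 0)) = (\<Prod>i\<in>UNIV. if i \<in> X then (x $ i)\<^sup>2 else 1)"
      by (rule prod.cong) auto
    then show "(\<Prod>i\<in>X. (x $ i)\<^sup>2) = monomial_at (\<lambda>i. if i \<in> X then 2 else 0) x"
      by (simp add: monomial_at_def prod.If_cases)
  qed simp
  finally show ?thesis by (simp add: add.commute)
qed

text \<open>By Tonelli the integral factors into one-dimensional integrals of the derivative of
  arctan, each finite.\<close>

lemma integrable_prod_inverse_one_plus_square:
  "integrable lborel (\<lambda>x :: real^'n::finite. \<Prod>i\<in>UNIV. inverse (1 + (x $ i)\<^sup>2))"
proof (rule integrableI_nonneg)
  have "integrable lborel (\<lambda>t :: real. inverse (1 + t\<^sup>2))"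
    using integrable_inverse_1_plus_square by (simp add: set_integrable_def)
  then have fin: "(\<integral>\<^sup>+t. ennreal (inverse (1 + t\<^sup>2)) \<partial>lborel) < \<infinity>"
    by (simp add: integrable_iff_bounded)
  have "(\<Prod>i\<in>UNIV. inverse (1 + (x $ i)\<^sup>2)) = (\<Prod>b\<in>Basis. inverse (1 + (x \<bullet> b)\<^sup>2))" for x :: "real^'n"
    by (rule prod_Basis_vec[symmetric])
  then have "(\<integral>\<^sup>+x. ennreal (\<Prod>i\<in>UNIV. inverse (1 + (x $ i)\<^sup>2)) \<partial>(lborel :: (real^'n) measure)) =
      (\<integral>\<^sup>+x. (\<Prod>b\<in>Basis. ennreal (inverse (1 + (x \<bullet> b)\<^sup>2))) \<partial>(lborel :: (real^'n) measure))"
    by (simp add: prod_ennreal)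
  also have "\<dots> = (\<Prod>b\<in>(Basis :: (real^'n) set). (\<integral>\<^sup>+t. ennreal (inverse (1 + t\<^sup>2)) \<partial>lborel))"
    by (rule nn_integral_lborel_prod) simp_all
  also have "\<dots> < \<infinity>"
    using fin by (simp add: power_less_top_ennreal)
  finally show "(\<integral>\<^sup>+x. ennreal (\<Prod>i\<in>UNIV. inverse (1 + (x $ i)\<^sup>2)) \<partial>(lborel :: (real^'n) measure)) < \<infinity>" .
qed (auto intro!: prod_nonneg)

lemma smooth_imp_continuous_on: "smooth f \<Longrightarrow> continuous_on UNIV f"
  unfolding smooth_def by (metis k_times_cont_differentiable.simps(1))

text \<open>The seminorms without derivatives (empty list \<open>js\<close>) and with exponents 0
  and 2 bound the product of all \<open>1 + (x $ i)^2\<close> times \<open>norm (f x)\<close>. Hence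
  \<open>f\<close> is dominated by a multiple of the integrable function above.\<close>

lemma schwartz_space_integrable:
  assumes f: "f \<in> schwartz_space"
  shows "integrable lborel f"
proof -
  define m :: "'a set \<Rightarrow> real^'a \<Rightarrow> real" where "m X = monomial_at (\<lambda>i. if i \<in> X then 2 else 0)" for X
  have "bounded (range (\<lambda>x. m X x *\<^sub>R f x))" for X
    using f unfolding schwartz_space_def m_def iterated_partial_def
    by (auto dest!: spec[of _ "\<lambda>i. if i \<in> X then 2 else 0"] spec[of _ "[]"])
  then have "\<exists>B. \<forall>x. norm (m X x *\<^sub>R f x) \<le> B" for X
    by (simp add: bounded_iff)
  then obtain B where B: "\<And>X x. norm (m X x *\<^sub>R f x) \<le> B X"
    by metis
  let ?p = "\<lambda>x :: real^'a. \<Prod>i\<in>UNIV. 1 + (x $ i)\<^sup>2"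
  let ?q = "\<lambda>x :: real^'a. \<Prod>i\<in>UNIV. inverse (1 + (x $ i)\<^sup>2)"
  have bound: "norm (f x) \<le> norm (sum B UNIV * ?q x)" for x
  proof -
    have pos: "?p x > 0"
      by (intro prod_pos) (auto intro: add_pos_nonneg)
    \<comment> \<open>All exponents are even, so the monomials can be moved into and out of the
      norm.\<close>
    have m: "m X x \<ge> 0" for X
      unfolding m_def monomial_at_def by (intro prod_nonneg) auto
    have "?p x * norm (f x) = (\<Sum>X\<in>UNIV. norm (m X x *\<^sub>R f x))"
      using m by (simp add: prod_one_plus_eq_sum_monomial_at sum_distrib_right m_def[symmetric])
    also have "\<dots> \<le> sum B UNIV"
      using B by (rule sum_mono)
    finally have "norm (f x) \<le> sum B UNIV / ?p x"
      using pos by (simp add: pos_le_divide_eq mult.commute)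
    also have "\<dots> = sum B UNIV * ?q x"
      by (simp add: divide_inverse prod_inversef[symmetric])
    finally show ?thesis by (simp only: real_norm_def)
  qed
  have "continuous_on UNIV f"
    using f by (simp add: schwartz_space_def smooth_imp_continuous_on)
  then have "f \<in> borel_measurable lborel"
    by (simp add: borel_measurable_continuous_onI)
  then show ?thesis
    using integrable_mult_right[OF integrable_prod_inverse_one_plus_square, of "sum B UNIV"] bound
    by (blast intro: Bochner_Integration.integrable_bound AE_I2)
qed

section \<open>Convolution\<close>

lemma
  fixes f :: "'a::euclidean_space \<Rightarrow> 'b::{banach,second_countable_topology}"
  assumes "integrable lborel f"
  shows lborel_integrable_diff: "integrable lborel (\<lambda>x. f (x - c))"
    and lborel_integral_diff: "(LINT x|lborel. f (x - c)) = (LINT x|lborel. f x)"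
proof -
  have f: "f \<in> borel_measurable borel"
    using borel_measurable_integrable[OF assms] by simp
  show "integrable lborel (\<lambda>x. f (x - c))"
    using integrable_distr_eq[of "(+) (-c)" lborel borel f] assms f by (simp add: lborel_distr_plus)
  show "(LINT x|lborel. f (x - c)) = (LINT x|lborel. f x)"
    using integral_distr[of "(+) (-c)" lborel borel f] f by (simp add: lborel_distr_plus)
qed

text \<open>The classical convolution theorem, for any measurable unitary character
  \<open>e\<close>. Writing \<open>e x\<close> as \<open>e (x - y) * e y\<close> separates the
  double integral after Fubini, and translation invariance removes \<open>y\<close> from the inner
  integral.\<close>

lemma integral_character_convolution:
  fixes e f g :: "'a::euclidean_space \<Rightarrow> complex"
  assumes f: "integrable lborel f" and g: "integrable lborel g"
    and e [measurable]: "e \<in> borel_measurable borel"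
    and norm_e: "\<And>x. norm (e x) = 1"
    and e_add: "\<And>x y. e (x + y) = e x * e y"
  shows "(LINT x|lborel. e x * (LINT y|lborel. f (x - y) * g y)) =
    (LINT x|lborel. e x * f x) * (LINT y|lborel. e y * g y)"
proof -
  have [measurable]: "f \<in> borel_measurable borel" "g \<in> borel_measurable borel"
    using borel_measurable_integrable[OF f] borel_measurable_integrable[OF g] by simp_all
  have ef: "integrable lborel (\<lambda>x. e x * f x)"
    by (rule Bochner_Integration.integrable_bound[OF f]) (simp_all add: norm_mult norm_e)
  let ?F = "\<lambda>y x. e x * (f (x - y) * g y)"
  have F_eq: "?F y x = (e (x - y) * f (x - y)) * (e y * g y)" for x y
    using e_add[of "x - y" y] by simp
  have "integrable (lborel \<Otimes>\<^sub>M lborel) (case_prod ?F)"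
  proof (rule lborel_pair.Fubini_integrable)
    show "case_prod ?F \<in> borel_measurable (lborel \<Otimes>\<^sub>M lborel)"
      by measurable
    \<comment> \<open>As \<open>e\<close> has modulus 1, the inner integral of the norm is the L1
      norm of \<open>f\<close> times \<open>norm (g y)\<close>, which is integrable in
      \<open>y\<close>.\<close>
    have "(LINT x|lborel. norm (?F y x)) = (LINT x|lborel. norm (f x)) * norm (g y)" for y
      using lborel_integral_diff[OF integrable_norm[OF f], of y] by (simp add: norm_mult norm_e)
    then show "integrable lborel (\<lambda>y. LINT x|lborel. norm (case_prod ?F (y, x)))"
      using g by simp
    show "AE y in lborel. integrable lborel (\<lambda>x. case_prod ?F (y, x))"
      unfolding case_prod_conv F_eq
      by (intro AE_I2 integrable_mult_left) (rule lborel_integrable_diff[OF ef])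
  qed
  then have "(LINT x|lborel. LINT y|lborel. ?F y x) = (LINT y|lborel. LINT x|lborel. ?F y x)"
    by (rule lborel_pair.Fubini_integral)
  also have "\<dots> = (LINT y|lborel. (LINT x|lborel. e x * f x) * (e y * g y))"
    unfolding F_eq by (simp only: integral_mult_left_zero lborel_integral_diff[OF ef])
  also have "\<dots> = (LINT x|lborel. e x * f x) * (LINT y|lborel. e y * g y)"
    by simp
  finally show ?thesis
    by simp
qed

section \<open>Diffeomorphisms\<close>

text \<open>The determinant is a polynomial in the first-order partial derivatives, which are
  continuous.\<close>

lemma borel_measurable_det_jacobian:
  assumes "smooth \<phi>"
  shows "(\<lambda>x. det (jacobian \<phi> (at x))) \<in> borel_measurable borel"
proof (rule borel_measurable_continuous_onI)
  have "k_times_cont_differentiable 1 \<phi>"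
    using assms by (simp only: smooth_def)
  then have cont: "continuous_on UNIV (\<lambda>x. frechet_derivative \<phi> (at x) (axis j 1) $ i)" for i j
    unfolding One_nat_def k_times_cont_differentiable.simps partial_deriv_def
    by (auto intro: continuous_on_component)
  then show "continuous_on UNIV (\<lambda>x. det (jacobian \<phi> (at x)))"
    unfolding det_def jacobian_def matrix_def
    by (auto intro!: continuous_on_sum continuous_on_mult continuous_on_prod continuous_on_const cont)
qed

text \<open>Integration of \<open>h\<close> against both sides of the measure identity. If
  \<open>h\<close> is not integrable, both integrals have the default value 0.\<close>

lemma integral_abs_jacobian:
  fixes h :: "real^'n::finite \<Rightarrow> complex"
  assumes \<phi>: "diffeomorphism \<phi>" and h: "h \<in> borel_measurable borel"
  shows "(LINT x|lborel. h (\<phi> x) * complex_of_real (abs_jacobian \<phi> x)) = (LINT u|lborel. h u)"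
proof -
  have sm: "smooth \<phi>" and bij: "bij \<phi>"
    using \<phi> by (simp_all add: diffeomorphism_def)
  have "k_times_cont_differentiable 1 \<phi>"
    using sm by (simp only: smooth_def)
  then have der: "(\<phi> has_derivative frechet_derivative \<phi> (at x)) (at x)" for x
    by (simp add: frechet_derivative_works)
  note [measurable] = h has_derivative_imp_borel_measurable[OF der] borel_measurable_det_jacobian[OF sm]
  have "distr (density lborel (\<lambda>x. ennreal (abs_jacobian \<phi> x))) borel \<phi> = lborel"
    using lborel_distr_density_det[OF der bij] borel_measurable_det_jacobian[OF sm]
    by (simp add: abs_jacobian_def jacobian_def)
  then have "(LINT u|lborel. h u) =
      (LINT u|distr (density lborel (\<lambda>x. ennreal (abs_jacobian \<phi> x))) borel \<phi>. h u)"
    by simp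
  also have "\<dots> = (LINT x|lborel. abs_jacobian \<phi> x *\<^sub>R h (\<phi> x))"
    by (simp add: integral_distr integral_density abs_jacobian_def)
  finally show ?thesis
    by (simp add: scaleR_conv_of_real mult.commute)
qed

section \<open>Reduction of the weighted convolution theorem to the classical one\<close>

theorem theorem4p2:
  fixes \<phi> :: "real^'n::finite \<Rightarrow> real^'n"
    and \<omega> f g :: "real^'n \<Rightarrow> complex"
  assumes "diffeomorphism \<phi>"
    and "\<forall>x. abs_jacobian \<phi> x \<noteq> 0"
    and "smooth \<omega>"
    and "\<forall>x. \<omega> x \<noteq> 0"
    and "f \<in> weighted_schwartz_space \<phi> \<omega>"
    and "g \<in> weighted_schwartz_space \<phi> \<omega>"
  shows "weighted_fourier \<phi> \<omega> (weighted_convolution \<phi> \<omega> f g) =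
    (\<lambda>\<xi>. weighted_fourier \<phi> \<omega> f \<xi> * weighted_fourier \<phi> \<omega> g \<xi>)"
proof
  fix \<xi> :: "real^'n"
  note \<phi> = \<open>diffeomorphism \<phi>\<close>
  have inv_\<phi>: "inv \<phi> (\<phi> x) = x" for x
    using \<phi> by (simp add: diffeomorphism_def bij_is_inj)
  define c where "c = complex_of_real ((2 * pi) powr (real CARD('n) / 2))"
  define e where "e u = exp (- (\<i> * complex_of_real (\<xi> \<bullet> u)))" for u
  define F where "F = weighted_pullback \<phi> \<omega> f"
  define G where "G = weighted_pullback \<phi> \<omega> g"
  \<comment> \<open>The classical convolution without its normalising factor; \<open>1 / c\<close>
    is kept apart.\<close>
  define H where "H u = (LINT v|lborel. F (u - v) * G v)" for u
  have F_int: "integrable lborel F" and G_int: "integrable lborel G"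
    using assms(5,6) by (simp_all add: F_def G_def weighted_schwartz_space_def schwartz_space_integrable)
  have [measurable]: "F \<in> borel_measurable borel" "G \<in> borel_measurable borel"
    using borel_measurable_integrable[OF F_int] borel_measurable_integrable[OF G_int] by simp_all
  have [measurable]: "e \<in> borel_measurable borel"
    unfolding e_def by (intro borel_measurable_continuous_onI continuous_intros)
  have [measurable]: "H \<in> borel_measurable borel"
    unfolding H_def by measurable
  \<comment> \<open>Here \<open>K\<close> is the pullback of \<open>\<omega> k\<close>, described by
    its composition with \<open>\<phi>\<close>. In this form the fact serves for \<open>f\<close>,
    \<open>g\<close> and their convolution alike.\<close>
  have fourier: "weighted_fourier \<phi> \<omega> k \<xi> = 1 / c * (LINT u|lborel. e u * K u)"
    if [measurable]: "K \<in> borel_measurable borel" and K: "\<And>x. \<omega> x * k x = K (\<phi> x)" for k K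
  proof -
    have "(LINT x|lborel. e (\<phi> x) * \<omega> x * k x * complex_of_real (abs_jacobian \<phi> x)) =
        (LINT x|lborel. e (\<phi> x) * K (\<phi> x) * complex_of_real (abs_jacobian \<phi> x))"
      by (simp add: K[symmetric] mult.assoc)
    also have "\<dots> = (LINT u|lborel. e u * K u)"
      by (rule integral_abs_jacobian[OF \<phi>]) measurable
    finally show ?thesis
      by (simp add: weighted_fourier_def c_def e_def)
  qed
  \<comment> \<open>The prefactor \<open>1 / \<omega> x\<close> of the convolution cancels because
    \<open>\<omega>\<close> has no zeros.\<close>
  have conv: "\<omega> x * weighted_convolution \<phi> \<omega> f g x = 1 / c * H (\<phi> x)" for x
  proof -
    have "(LINT y|lborel. F (\<phi> x - \<phi> y) * G (\<phi> y) * complex_of_real (abs_jacobian \<phi> y)) = H (\<phi> x)"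
      unfolding H_def by (rule integral_abs_jacobian[OF \<phi>]) measurable
    then show ?thesis
      using assms(4) by (simp add: weighted_convolution_def F_def G_def c_def)
  qed
  \<comment> \<open>One factor \<open>1 / c\<close> comes from the transform and one from the
    convolution; at the end each of the two transforms on the right receives one.\<close>
  have "weighted_fourier \<phi> \<omega> (weighted_convolution \<phi> \<omega> f g) \<xi> =
      1 / c * (LINT u|lborel. e u * (1 / c * H u))"
    by (rule fourier) (simp_all add: conv)
  also have "\<dots> = 1 / c * (1 / c * (LINT u|lborel. e u * H u))"
    by (simp add: mult.left_commute)
  also have "(LINT u|lborel. e u * H u) = (LINT u|lborel. e u * F u) * (LINT v|lborel. e v * G v)"
    unfolding H_def
  proof (rule integral_character_convolution[OF F_int G_int])
    show "norm (e u) = 1" for u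
      by (simp add: e_def)
    show "e (u + v) = e u * e v" for u v
      unfolding e_def exp_add[symmetric] by (simp add: inner_add_right distrib_left)
  qed measurable
  also have "1 / c * (1 / c * \<dots>) =
      (1 / c * (LINT u|lborel. e u * F u)) * (1 / c * (LINT v|lborel. e v * G v))"
    by (simp only: mult_ac)
  also have "1 / c * (LINT u|lborel. e u * F u) = weighted_fourier \<phi> \<omega> f \<xi>"
    by (rule fourier[symmetric]) (measurable, simp add: F_def weighted_pullback_def inv_\<phi>)
  also have "1 / c * (LINT v|lborel. e v * G v) = weighted_fourier \<phi> \<omega> g \<xi>"
    by (rule fourier[symmetric]) (measurable, simp add: G_def weighted_pullback_def inv_\<phi>)
  finally show "weighted_fourier \<phi> \<omega> (weighted_convolution \<phi> \<omega> f g) \<xi> =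
      weighted_fourier \<phi> \<omega> f \<xi> * weighted_fourier \<phi> \<omega> g \<xi>" .
qed

end
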